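(* Let $K\subset\mathbb{R}^n$ be a convex body with the origin in its interior, and let $r,s,t$ be real numbers. (i) If $-n<t<0<r<s$ or $-n<s<0<r<t$, then $$\tilde G_r(K)\le\tilde G_t(K)^{\frac{(r-s)(n+t)}{(t-s)(n+r)}}\ \tilde G_s(K)^{\frac{(t-r)(n+s)}{(t-s)(n+r)}}.$$ (ii) If $-n<t<r<s<0$ or $-n<s<r<t<0$, then $$\tilde G_r(K)\le\tilde G_t(K)^{\frac{(r-s)(n+t)}{(t-s)(n+r)}}\ \tilde G_s(K)^{\frac{(t-r)(n+s)}{(t-s)(n+r)}}.$$ (iii) If $t<r<-n<s<0$ or $s<r<-n<t<0$, then $$\tilde G_r(K)\ge\tilde G_t(K)^{\frac{(r-s)(n+t)}{(t-s)(n+r)}}\ \tilde G_s(K)^{\frac{(t-r)(n+s)}{(t-s)(n+r)}}.$$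
   Context: A convex body in $\mathbb{R}^n$ is a compact convex set with nonempty interior; $\mathcal{K}_0$ is the set of convex bodies containing the origin in their interior. For $K\in\mathcal{K}_0$, $K^\circ=\{y\in\mathbb{R}^n:\langle x,y\rangle\le1\ \forall x\in K\}$ is the polar body, $h_K(u)=\max_{x\in K}\langle x,u\rangle$ ($u\in S^{n-1}$) is the support function, and $|\cdot|$ is volume. $S(K,\cdot)$ is the surface area measure of $K$ on the unit sphere $S^{n-1}$: for a Borel set $A\subset S^{n-1}$, $S(K,A)$ is the $(n-1)$-dimensional Hausdorff measure of the set of $x\in\partial K$ at which $K$ has an outer unit normal in $A$. For $p\in\mathbb{R}$ and $K,Q\in\mathcal{K}_0$, $$V_p(K,Q)=\frac1n\int_{S^{n-1}}h_Q(u)^p\,h_K(u)^{1-p}\,dS(K,u).$$ The $L_p$ geominimal surface area of $K\in\mathcal{K}_0$ is defined by $$\tilde G_p(K)=\inf_{Q\in\mathcal{K}_0}\Big\{n\,V_p(K,Q)^{\frac n{n+p}}|Q^\circ|^{\frac p{n+p}}\Big\}\quad\text{for } p\ge0,$$ $$\tilde G_p(K)=\sup_{Q\in\mathcal{K}_0}\Big\{n\,V_p(K,Q)^{\frac n{n+p}}|Q^\circ|^{\frac p{n+p}}\Big\}\quad\text{for } -n\ne p<0.$$ *)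

theory Defs
  imports "HOL-Analysis.Analysis"
begin

text \<open>The space $\mathbb{R}^n$ is a type \<open>'a::euclidean_space\<close> with $n$ = \<open>DIM('a)\<close>.\<close>

definition convex_body :: "'a::euclidean_space set \<Rightarrow> bool" where
  "convex_body K \<longleftrightarrow> compact K \<and> convex K \<and> interior K \<noteq> {}"

definition convex_bodies_0 :: "'a::euclidean_space set set" where
  "convex_bodies_0 = {K. convex_body K \<and> 0 \<in> interior K}"

definition polar_body :: "'a::euclidean_space set \<Rightarrow> 'a set" where
  "polar_body K = {y. \<forall>x\<in>K. x \<bullet> y \<le> 1}"

text \<open>For a convex body the supremum is a maximum.\<close>
definition support_fun :: "'a::euclidean_space set \<Rightarrow> 'a \<Rightarrow> real" where
  "support_fun K u = (SUP x\<in>K. x \<bullet> u)"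

text \<open>
  The \<open>d\<close>-dimensional Hausdorff (outer) measure, normalised by the volume of the unit
  \<open>d\<close>-ball so that it agrees with Lebesgue measure on $\mathbb{R}^d$. Covering sets are required
  to be bounded because \<open>diameter\<close> is unspecified on unbounded sets. The empty set gets weight
  \<open>0\<close> explicitly, since for \<open>d = 0\<close> the formula would give \<open>0 ^ 0 = 1\<close>; thus \<open>d = 0\<close> is
  counting measure.
\<close>
definition hausdorff_weight :: "nat \<Rightarrow> 'a::metric_space set \<Rightarrow> ennreal" where
  "hausdorff_weight d C =
     (if C = {} then 0 else ennreal (unit_ball_vol (real d) * (diameter C / 2) ^ d))"

definition hausdorff_content :: "nat \<Rightarrow> real \<Rightarrow> 'a::metric_space set \<Rightarrow> ennreal" where
  "hausdorff_content d \<delta> A =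
     (INF C \<in> {C :: nat \<Rightarrow> 'a set. A \<subseteq> (\<Union>i. C i) \<and> (\<forall>i. bounded (C i) \<and> diameter (C i) \<le> \<delta>)}.
        \<Sum>i. hausdorff_weight d (C i))"

definition hausdorff_outer_measure :: "nat \<Rightarrow> 'a::metric_space set \<Rightarrow> ennreal" where
  "hausdorff_outer_measure d A = (SUP \<delta>\<in>{0<..}. hausdorff_content d \<delta> A)"

definition outer_unit_normals :: "'a::euclidean_space set \<Rightarrow> 'a \<Rightarrow> 'a set" where
  "outer_unit_normals K x = {u \<in> sphere 0 1. \<forall>y\<in>K. y \<bullet> u \<le> x \<bullet> u}"

text \<open>
  \<open>measure_of\<close> turns a set function into a measure when it is countably additive on the given
  $\sigma$-algebra (here the Borel sets of the unit sphere) and yields the zero measure otherwise.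
  For a convex body countable additivity holds: the reverse spherical image of a Borel set is
  Hausdorff measurable, and the boundary points with more than one outer unit normal form a
  null set.
\<close>
definition surface_area_measure :: "'a::euclidean_space set \<Rightarrow> 'a measure" where
  "surface_area_measure K =
     measure_of (sphere 0 1) (sets (restrict_space borel (sphere 0 1)))
       (\<lambda>A. hausdorff_outer_measure (DIM('a) - 1)
              {x \<in> frontier K. outer_unit_normals K x \<inter> A \<noteq> {}})"

text \<open>Real powers on $[0,\infty]$, with $0^a = \infty$ and $\infty^a = 0$ for $a < 0$, and $x^0 = 1$.\<close>
definition ennreal_powr :: "ennreal \<Rightarrow> real \<Rightarrow> ennreal" (infixr \<open>epowr\<close> 80) where
  "x epowr a =
     (if a = 0 then 1
      else if x = 0 then (if a < 0 then top else 0)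
      else if x = top then (if a < 0 then 0 else top)
      else ennreal (enn2real x powr a))"

definition mixed_volume_p :: "real \<Rightarrow> 'a::euclidean_space set \<Rightarrow> 'a set \<Rightarrow> ennreal" where
  "mixed_volume_p p K Q =
     ennreal (1 / real DIM('a)) *
     (\<integral>\<^sup>+ u. ennreal (support_fun Q u powr p * support_fun K u powr (1 - p))
        \<partial>surface_area_measure K)"

definition geominimal_functional :: "real \<Rightarrow> 'a::euclidean_space set \<Rightarrow> 'a set \<Rightarrow> ennreal" where
  "geominimal_functional p K Q =
     ennreal (real DIM('a)) *
     mixed_volume_p p K Q epowr (real DIM('a) / (real DIM('a) + p)) *
     emeasure lborel (polar_body Q) epowr (p / (real DIM('a) + p))"

text \<open>
  The value lies in $[0,\infty]$; for polytopes in dimension at least \<open>2\<close> it is $\infty$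
  for every \<open>p < 0\<close>, \<open>p \<noteq> - DIM('a)\<close>. The definition is meaningful only for \<open>p \<noteq> - DIM('a)\<close>.
\<close>
definition geominimal_surface_area :: "real \<Rightarrow> 'a::euclidean_space set \<Rightarrow> ennreal" where
  "geominimal_surface_area p K =
     (if p \<ge> 0 then (INF Q\<in>convex_bodies_0. geominimal_functional p K Q)
      else (SUP Q\<in>convex_bodies_0. geominimal_functional p K Q))"

end

theory Submission
  imports Defs
begin

text \<open>
  Hoelder's inequality makes \<open>p \<mapsto> V\<^sub>p(K, Q)\<close> log-convex for fixed \<open>Q\<close>. Writing \<open>F\<^sub>p(Q)\<close> for the
  functional under the infimum or supremum, $F_p^{n+p} = n^{n+p} V_p^n |Q^\circ|^p$, so
  $p \mapsto F_p^{n+p}$ is log-convex as well; taking roots and passing to the infimum or supremum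
  over \<open>Q\<close> gives the three claims. This uses no property of \<open>S(K, \<cdot>)\<close> beyond its being a Borel
  measure on the sphere: if its total mass is \<open>0\<close> or \<open>\<infinity>\<close>, every functional is \<open>0\<close> or \<open>\<infinity>\<close> and
  the inequalities are checked directly.
\<close>

section \<open>Convex bodies, their support functions and the volume of their polars\<close>

lemma convex_bodies_0_bounds:
  fixes K :: "'a::euclidean_space set"
  assumes "K \<in> convex_bodies_0"
  obtains e R where "0 < e" "0 < R" "cball 0 e \<subseteq> K" "K \<subseteq> cball 0 R"
proof -
  have "0 \<in> interior K" "bounded K"
    using assms by (auto simp: convex_bodies_0_def convex_body_def compact_imp_bounded)
  obtain e where e: "0 < e" "cball 0 e \<subseteq> K"
    using \<open>0 \<in> interior K\<close> by (auto simp: mem_interior_cball)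
  obtain R where "0 < R" "\<forall>x\<in>K. norm x \<le> R"
    using \<open>bounded K\<close> by (auto simp: bounded_pos)
  then show thesis using e by (intro that[of e R]) auto
qed

text \<open>A norm bound \<open>R\<close> for \<open>K\<close> is a Lipschitz constant of the
  support function: split \<open>x \<bullet> u\<close> as
  \<open>x \<bullet> v + x \<bullet> (u - v)\<close> and apply Cauchy-Schwarz to the second
  term.\<close>

lemma continuous_on_support_fun:
  fixes K :: "'a::euclidean_space set"
  assumes "bounded K" "K \<noteq> {}"
  shows "continuous_on S (support_fun K)"
proof -
  obtain R where R: "0 < R" "\<forall>x\<in>K. norm x \<le> R"
    using \<open>bounded K\<close> by (auto simp: bounded_pos)
  have inner: "x \<bullet> u \<le> R * norm u" if "x \<in> K" for x u
    using R that norm_cauchy_schwarz[of x u] mult_right_mono[of "norm x" R "norm u"] by auto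
  have bdd: "bdd_above ((\<lambda>x. x \<bullet> u) ` K)" for u
    using inner by (intro bdd_aboveI2[of _ _ "R * norm u"]) auto
  have le: "support_fun K u \<le> support_fun K v + R * norm (u - v)" for u v
    unfolding support_fun_def
  proof (rule cSUP_least[OF \<open>K \<noteq> {}\<close>])
    fix x assume x: "x \<in> K"
    have "x \<bullet> u = x \<bullet> v + x \<bullet> (u - v)" by (simp add: inner_diff_right)
    also have "\<dots> \<le> (SUP x\<in>K. x \<bullet> v) + R * norm (u - v)"
      by (intro add_mono cSUP_upper bdd x inner)
    finally show "x \<bullet> u \<le> (SUP x\<in>K. x \<bullet> v) + R * norm (u - v)" .
  qed
  have "dist (support_fun K u) (support_fun K v) \<le> R * dist u v" for u v
    using le[of u v] le[of v u] by (simp add: dist_real_def dist_norm norm_minus_commute)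
  then have "R-lipschitz_on S (support_fun K)"
    using R by (intro lipschitz_onI) auto
  then show ?thesis by (rule lipschitz_on_continuous_on)
qed

lemma support_fun_pos:
  fixes K :: "'a::euclidean_space set"
  assumes "K \<in> convex_bodies_0" "norm u = 1"
  shows "0 < support_fun K u"
proof -
  obtain e R where eR: "0 < e" "0 < R" "cball 0 e \<subseteq> K" "K \<subseteq> cball 0 R"
    using convex_bodies_0_bounds[OF assms(1)] .
  have "x \<bullet> u \<le> R" if "x \<in> K" for x
    using norm_cauchy_schwarz[of x u] eR(4) that assms(2) by auto
  then have bdd: "bdd_above ((\<lambda>x. x \<bullet> u) ` K)"
    by (intro bdd_aboveI2) auto
  have "e *\<^sub>R u \<in> K" using eR assms(2) by auto
  then have "(e *\<^sub>R u) \<bullet> u \<le> support_fun K u"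
    unfolding support_fun_def by (intro cSUP_upper bdd)
  then show ?thesis using eR(1) assms(2) by (simp add: dot_square_norm)
qed

text \<open>Polarity reverses inclusions: a body between balls of radius \<open>e\<close> and
  \<open>R\<close> has its polar between balls of radius \<open>1 / R\<close> and
  \<open>1 / e\<close>.\<close>

lemma emeasure_polar_body_pos_finite:
  fixes Q :: "'a::euclidean_space set"
  assumes "Q \<in> convex_bodies_0"
  shows "0 < emeasure lborel (polar_body Q)" "emeasure lborel (polar_body Q) < \<infinity>"
proof -
  obtain e R where eR: "0 < e" "0 < R" "cball 0 e \<subseteq> Q" "Q \<subseteq> cball 0 R"
    using convex_bodies_0_bounds[OF assms] .
  have "polar_body Q = (\<Inter>x\<in>Q. {y. x \<bullet> y \<le> 1})"
    by (auto simp: polar_body_def)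
  then have "closed (polar_body Q)"
    by (auto intro!: closed_INT closed_halfspace_le)
  then have meas: "polar_body Q \<in> sets lborel" by auto
  have "ball 0 (1 / R) \<subseteq> polar_body Q"
  proof
    fix y :: 'a assume "y \<in> ball 0 (1 / R)"
    then have y: "norm y \<le> 1 / R" by auto
    have "x \<bullet> y \<le> 1" if "x \<in> Q" for x
    proof -
      have "x \<bullet> y \<le> norm x * norm y" by (rule norm_cauchy_schwarz)
      also have "\<dots> \<le> R * (1 / R)" using eR that y by (intro mult_mono) auto
      finally show ?thesis using eR by simp
    qed
    then show "y \<in> polar_body Q" by (auto simp: polar_body_def)
  qed
  then have "emeasure lborel (ball 0 (1 / R) :: 'a set) \<le> emeasure lborel (polar_body Q)"
    using meas by (intro emeasure_mono)
  moreover have "0 < emeasure lborel (ball 0 (1 / R) :: 'a set)"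
    using eR by (simp add: emeasure_ball zero_less_iff_neq_zero ennreal_eq_0_iff unit_ball_vol_pos not_le)
  ultimately show "0 < emeasure lborel (polar_body Q)" by simp
  have "norm y \<le> 1 / e" if "y \<in> polar_body Q" for y
  proof (cases "y = 0")
    case False
    \<comment> \<open>The point of norm \<open>e\<close> in direction \<open>y\<close> lies in
      \<open>Q\<close>, and its inner product with \<open>y\<close> is
      \<open>e * norm y\<close>.\<close>
    have "(e / norm y) *\<^sub>R y \<in> Q" using eR False by auto
    then have "((e / norm y) *\<^sub>R y) \<bullet> y \<le> 1" using that by (auto simp: polar_body_def)
    then have "e * norm y \<le> 1" using False by (simp add: dot_square_norm power2_eq_square)
    then show ?thesis using eR by (simp add: field_simps)
  qed (use eR in auto)
  then have "bounded (polar_body Q)" by (auto simp: bounded_iff)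
  then show "emeasure lborel (polar_body Q) < \<infinity>" by (rule emeasure_bounded_finite)
qed

section \<open>Carrier and sigma-algebra of the surface area measure\<close>

text \<open>\<open>measure_of\<close> keeps the given carrier and sigma-algebra even where it falls
  back to the zero measure, so both can be read off from the definition.\<close>

lemma space_surface_area_measure [simp]: "space (surface_area_measure K) = sphere 0 1"
  unfolding surface_area_measure_def
  using sets.space_closed[of "restrict_space borel (sphere (0::'a) 1)"]
  by (intro space_measure_of) (simp add: space_restrict_space)

lemma sets_surface_area_measure [measurable_cong]:
  "sets (surface_area_measure K) = sets (restrict_space borel (sphere 0 1))"
  unfolding surface_area_measure_def
  using sets.space_closed[of "restrict_space borel (sphere (0::'a) 1)"]
    sets.sigma_sets_eq[of "restrict_space borel (sphere (0::'a) 1)"]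
  by (subst sets_measure_of) (simp_all add: space_restrict_space)

section \<open>Arithmetic of real powers on [0, \<infinity>]\<close>

lemma epowr_ennreal: "0 < x \<Longrightarrow> ennreal x epowr a = ennreal (x powr a)"
  by (simp add: ennreal_powr_def)

lemma epowr_eq_0_iff: "0 < a \<Longrightarrow> x epowr a = 0 \<longleftrightarrow> x = 0"
  by (cases x) (auto simp: ennreal_powr_def ennreal_eq_0_iff)

lemma epowr_eq_top_iff: "0 < a \<Longrightarrow> x epowr a = top \<longleftrightarrow> x = top"
  by (cases x) (auto simp: ennreal_powr_def)

lemma epowr_mono: "0 < a \<Longrightarrow> x \<le> y \<Longrightarrow> x epowr a \<le> y epowr a"
  by (cases x; cases y)
    (auto simp: ennreal_powr_def ennreal_eq_0_iff top_unique intro!: ennreal_leI powr_mono2)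

lemma epowr_antimono: "a < 0 \<Longrightarrow> x \<le> y \<Longrightarrow> y epowr a \<le> x epowr a"
  by (cases x; cases y)
    (auto simp: ennreal_powr_def ennreal_eq_0_iff top_unique intro!: ennreal_leI powr_mono2')

lemma epowr_epowr_inverse: "0 < a \<Longrightarrow> (x epowr a) epowr (1 / a) = x"
  by (cases x) (auto simp: ennreal_powr_def ennreal_eq_0_iff powr_powr)

text \<open>A positive power is an order automorphism of [0, \<infinity>] with inverse the
  reciprocal power. In this form it moves across inequalities, which later lets it pass through
  infima and suprema.\<close>

lemma le_epowr_iff:
  assumes "0 < a"
  shows "x \<le> y epowr a \<longleftrightarrow> x epowr (1 / a) \<le> y"
proof
  assume "x \<le> y epowr a"
  then have "x epowr (1 / a) \<le> (y epowr a) epowr (1 / a)"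
    using assms by (intro epowr_mono) auto
  then show "x epowr (1 / a) \<le> y" using assms by (simp add: epowr_epowr_inverse)
next
  assume "x epowr (1 / a) \<le> y"
  then have "(x epowr (1 / a)) epowr a \<le> y epowr a" by (rule epowr_mono[OF assms])
  then show "x \<le> y epowr a" using epowr_epowr_inverse[of "1 / a" x] assms by simp
qed

lemma epowr_le_iff:
  assumes "0 < a"
  shows "x epowr a \<le> y \<longleftrightarrow> x \<le> y epowr (1 / a)"
  using le_epowr_iff[of "1 / a" x y] assms by simp

lemma ennreal_divide_le_iff:
  fixes c x y :: ennreal
  assumes "c \<noteq> 0" "c \<noteq> top"
  shows "x / c \<le> y \<longleftrightarrow> x \<le> c * y"
proof
  assume "x / c \<le> y"
  then have "c * (x / c) \<le> c * y" by (intro mult_left_mono) auto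
  moreover have "c * (x / c) = x"
    using assms by (simp add: ennreal_times_divide mult.commute[of c] mult_divide_eq_ennreal)
  ultimately show "x \<le> c * y" by simp
qed (use assms in \<open>auto intro: divide_le_posI_ennreal simp: zero_less_iff_neq_zero\<close>)

text \<open>For \<open>0 < c < \<infinity>\<close> the bound can be solved for \<open>f Q\<close>,
  giving a lower bound for the infimum. For \<open>c = 0\<close> any member of \<open>S\<close>
  yields \<open>x \<le> 0\<close>. With \<open>c = \<infinity>\<close> the claim can fail: all
  \<open>f Q\<close> may be positive with infimum \<open>0\<close>, and
  \<open>\<infinity> * 0 = 0\<close>.\<close>

lemma le_times_INF_epowr:
  fixes f :: "'b \<Rightarrow> ennreal"
  assumes "0 < b" "c \<noteq> top" "S \<noteq> {}" and le: "\<And>Q. Q \<in> S \<Longrightarrow> x \<le> c * f Q epowr b"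
  shows "x \<le> c * (INF Q\<in>S. f Q) epowr b"
proof (cases "c = 0")
  case True
  then show ?thesis using le \<open>S \<noteq> {}\<close> by auto
next
  case False
  then have "(x / c) epowr (1 / b) \<le> (INF Q\<in>S. f Q)"
    using assms by (intro INF_greatest) (simp add: ennreal_divide_le_iff flip: le_epowr_iff)
  then show ?thesis
    using assms False by (simp add: ennreal_divide_le_iff flip: le_epowr_iff)
qed

text \<open>Dividing by a nonzero \<open>c\<close> and taking the \<open>1 / a\<close>-th power
  turns the hypothesis into one common upper bound for all \<open>f Q\<close>, hence for their
  supremum.\<close>

lemma SUP_epowr_times_le:
  fixes f :: "'b \<Rightarrow> ennreal"
  assumes "0 < a" "c \<noteq> top" and le: "\<And>Q. Q \<in> S \<Longrightarrow> f Q epowr a * c \<le> x"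
  shows "(SUP Q\<in>S. f Q) epowr a * c \<le> x"
proof (cases "c = 0")
  case False
  then have iff: "z * c \<le> x \<longleftrightarrow> z \<le> x / c" for z
    using assms divide_less_ennreal[of c x z] by (simp add: less_top not_less flip: linorder_not_less)
  have "(SUP Q\<in>S. f Q) \<le> (x / c) epowr (1 / a)"
    using assms by (intro SUP_least) (simp add: iff epowr_le_iff)
  then show ?thesis using assms by (simp add: iff epowr_le_iff)
qed simp

section \<open>Comparing the mixed volume with the total mass of the surface area measure\<close>

lemma convex_bodies_0_not_empty: "K \<in> convex_bodies_0 \<Longrightarrow> K \<noteq> {}"
  by (auto simp: convex_bodies_0_def convex_body_def)

text \<open>The integrand is continuous and positive on the compact sphere, so it lies between a
  positive minimum and a finite maximum. Hence the mixed volume is zero, or infinite, exactly when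
  the total mass is.\<close>

lemma mixed_volume_p_bounds:
  fixes K Q :: "'a::euclidean_space set"
  assumes K: "K \<in> convex_bodies_0" and Q: "Q \<in> convex_bodies_0"
  obtains c C where "0 < c" "0 < C"
    "ennreal c * emeasure (surface_area_measure K) (sphere 0 1) \<le> mixed_volume_p p K Q"
    "mixed_volume_p p K Q \<le> ennreal C * emeasure (surface_area_measure K) (sphere 0 1)"
proof -
  let ?S = "sphere (0::'a) 1" and ?M = "surface_area_measure K" and ?n = "real DIM('a)"
  define f where "f u = support_fun Q u powr p * support_fun K u powr (1 - p)" for u
  have pos: "0 < support_fun Q u" "0 < support_fun K u" if "u \<in> ?S" for u
    using that K Q by (auto intro: support_fun_pos)
  have "bounded K" "bounded Q"
    using K Q by (auto simp: convex_bodies_0_def convex_body_def compact_imp_bounded)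
  then have "continuous_on ?S (support_fun K)" "continuous_on ?S (support_fun Q)"
    using K Q by (auto intro!: continuous_on_support_fun convex_bodies_0_not_empty)
  then have "continuous_on ?S f"
    unfolding f_def using pos by (intro continuous_intros) force+
  moreover have "?S \<noteq> {}" by simp
  ultimately obtain u v where uv: "u \<in> ?S" "\<forall>w\<in>?S. f u \<le> f w" "v \<in> ?S" "\<forall>w\<in>?S. f w \<le> f v"
    using continuous_attains_inf[of ?S f] continuous_attains_sup[of ?S f] compact_sphere by blast
  have fpos: "0 < f w" if "w \<in> ?S" for w
    using pos[OF that] by (simp add: f_def)
  have "(\<integral>\<^sup>+w. ennreal (f u) \<partial>?M) \<le> (\<integral>\<^sup>+w. ennreal (f w) \<partial>?M)"
    using uv by (intro nn_integral_mono) (auto intro!: ennreal_leI)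
  then have "ennreal (1 / ?n) * (ennreal (f u) * emeasure ?M ?S) \<le> mixed_volume_p p K Q"
    unfolding mixed_volume_p_def f_def[symmetric] by (intro mult_left_mono) auto
  moreover have "(\<integral>\<^sup>+w. ennreal (f w) \<partial>?M) \<le> (\<integral>\<^sup>+w. ennreal (f v) \<partial>?M)"
    using uv by (intro nn_integral_mono) (auto intro!: ennreal_leI)
  then have "mixed_volume_p p K Q \<le> ennreal (1 / ?n) * (ennreal (f v) * emeasure ?M ?S)"
    unfolding mixed_volume_p_def f_def[symmetric] by (intro mult_left_mono) auto
  moreover have "ennreal (1 / ?n * y) * emeasure ?M ?S = ennreal (1 / ?n) * (ennreal y * emeasure ?M ?S)"
    for y
    by (simp only: ennreal_mult' zero_le_divide_1_iff of_nat_0_le_iff mult.assoc)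
  ultimately show thesis
    using fpos[OF uv(1)] fpos[OF uv(3)] that[of "1 / ?n * f u" "1 / ?n * f v"] by simp
qed

text \<open>The mixed volume equals \<open>m\<close> when \<open>m\<close> is \<open>0\<close> or
  \<open>\<infinity>\<close>, and the polar factor is positive and finite. The value is therefore
  decided by the sign of the exponent \<open>n / (n + p)\<close>, that is, of
  \<open>n + p\<close>.\<close>

lemma geominimal_functional_degenerate:
  fixes K Q :: "'a::euclidean_space set"
  assumes K: "K \<in> convex_bodies_0" and Q: "Q \<in> convex_bodies_0"
    and m: "emeasure (surface_area_measure K) (sphere 0 1) = m" and p: "real DIM('a) + p \<noteq> 0"
  shows "m = 0 \<Longrightarrow> geominimal_functional p K Q = (if real DIM('a) + p > 0 then 0 else top)"
    and "m = top \<Longrightarrow> geominimal_functional p K Q = (if real DIM('a) + p > 0 then top else 0)"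
proof -
  obtain c C where cC: "0 < c" "0 < C" "ennreal c * m \<le> mixed_volume_p p K Q"
    "mixed_volume_p p K Q \<le> ennreal C * m"
    using mixed_volume_p_bounds[OF K Q, of p] m by metis
  obtain w where w: "emeasure lborel (polar_body Q) = ennreal w" "0 < w"
    using emeasure_polar_body_pos_finite[OF Q] by (cases "emeasure lborel (polar_body Q)") auto
  have q: "real DIM('a) / (real DIM('a) + p) < 0 \<longleftrightarrow> \<not> real DIM('a) + p > 0"
     "real DIM('a) / (real DIM('a) + p) \<noteq> 0"
    using p by (auto simp: divide_less_0_iff)
  show "geominimal_functional p K Q = (if real DIM('a) + p > 0 then 0 else top)" if "m = 0"
    using cC that w q unfolding geominimal_functional_def
    by (simp add: ennreal_powr_def ennreal_mult_top ennreal_top_mult not_le)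
  show "geominimal_functional p K Q = (if real DIM('a) + p > 0 then top else 0)" if "m = top"
    using cC that w q unfolding geominimal_functional_def
    by (simp add: ennreal_powr_def ennreal_mult_top ennreal_top_mult top_unique not_le)
qed

lemma mixed_volume_p_pos_finite:
  fixes K Q :: "'a::euclidean_space set"
  assumes K: "K \<in> convex_bodies_0" and Q: "Q \<in> convex_bodies_0"
  shows "emeasure (surface_area_measure K) (sphere 0 1) \<noteq> 0 \<Longrightarrow> mixed_volume_p p K Q \<noteq> 0"
    and "emeasure (surface_area_measure K) (sphere 0 1) \<noteq> top \<Longrightarrow> mixed_volume_p p K Q \<noteq> top"
proof -
  let ?m = "emeasure (surface_area_measure K) (sphere 0 1)"
  obtain c C where cC: "0 < c" "0 < C" "ennreal c * ?m \<le> mixed_volume_p p K Q"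
    "mixed_volume_p p K Q \<le> ennreal C * ?m"
    using mixed_volume_p_bounds[OF K Q] .
  show "mixed_volume_p p K Q \<noteq> 0" if "?m \<noteq> 0"
    using cC that by (auto simp: ennreal_eq_0_iff)
  show "mixed_volume_p p K Q \<noteq> top" if "?m \<noteq> top"
    using cC(4) that by (auto simp: top_unique ennreal_mult_eq_top_iff)
qed

section \<open>Hoelder's inequality and log-convexity in the exponent\<close>

text \<open>Normalise to \<open>f / A\<close> and \<open>g / B\<close>, which have integral one,
  apply Young's inequality pointwise and integrate: the right side becomes \<open>a + b = 1\<close>,
  up to the scaling factor \<open>A powr a * B powr b\<close>.\<close>

lemma nn_integral_Holder:
  fixes f g :: "'a \<Rightarrow> real"
  assumes [measurable]: "f \<in> borel_measurable M" "g \<in> borel_measurable M"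
    and pos: "\<And>x. x \<in> space M \<Longrightarrow> 0 < f x" "\<And>x. x \<in> space M \<Longrightarrow> 0 < g x"
    and A: "(\<integral>\<^sup>+x. ennreal (f x) \<partial>M) = ennreal A" "0 < A"
    and B: "(\<integral>\<^sup>+x. ennreal (g x) \<partial>M) = ennreal B" "0 < B"
    and lam: "0 < a" "0 < b" "a + b = 1"
  shows "(\<integral>\<^sup>+x. ennreal (f x powr a * g x powr b) \<partial>M) \<le> ennreal (A powr a * B powr b)"
proof -
  let ?c = "A powr a * B powr b"
  have young: "f x powr a * g x powr b \<le> ?c * a / A * f x + ?c * b / B * g x"
    if "x \<in> space M" for x
  proof -
    have "(f x / A) powr a * (g x / B) powr b \<le> a * (f x / A) + b * (g x / B)"
      using lam A B pos[OF that] by (intro Youngs_inequality_0) auto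
    then have "?c * ((f x / A) powr a * (g x / B) powr b) \<le> ?c * (a * (f x / A) + b * (g x / B))"
      by (intro mult_left_mono) auto
    moreover have "?c * ((f x / A) powr a * (g x / B) powr b) = f x powr a * g x powr b"
      using A B pos[OF that] by (simp add: powr_divide)
    ultimately show ?thesis by (simp add: algebra_simps)
  qed
  have "(\<integral>\<^sup>+x. ennreal (f x powr a * g x powr b) \<partial>M)
      \<le> (\<integral>\<^sup>+x. ennreal (?c * a / A) * ennreal (f x) + ennreal (?c * b / B) * ennreal (g x) \<partial>M)"
  proof (rule nn_integral_mono)
    fix x assume x: "x \<in> space M"
    have "ennreal (?c * a / A) * ennreal (f x) + ennreal (?c * b / B) * ennreal (g x)
        = ennreal (?c * a / A * f x + ?c * b / B * g x)"
      using A B lam pos[OF x] by (subst ennreal_plus) (auto simp flip: ennreal_mult)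
    then show "ennreal (f x powr a * g x powr b)
        \<le> ennreal (?c * a / A) * ennreal (f x) + ennreal (?c * b / B) * ennreal (g x)"
      using young[OF x] by (simp add: ennreal_leI)
  qed
  also have "\<dots> = ennreal (?c * a / A) * ennreal A + ennreal (?c * b / B) * ennreal B"
    by (simp add: nn_integral_add nn_integral_cmult A B)
  also have "\<dots> = ennreal (?c * a / A * A + ?c * b / B * B)"
    using A B lam by (subst ennreal_plus) (auto simp flip: ennreal_mult)
  also have "?c * a / A * A + ?c * b / B * B = ?c * (a + b)"
    using A B by (simp add: algebra_simps)
  finally show ?thesis using lam by simp
qed

text \<open>The integrand is \<open>h_K * (h_Q / h_K) powr p\<close>, which is log-affine in
  \<open>p\<close>. At \<open>a * t + b * s\<close> it is thus the weighted geometric mean of the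
  integrands at \<open>t\<close> and \<open>s\<close>, and Hoelder's inequality applies.\<close>

lemma mixed_volume_p_log_convex:
  fixes K Q :: "'a::euclidean_space set"
  assumes K: "K \<in> convex_bodies_0" and Q: "Q \<in> convex_bodies_0"
    and V: "mixed_volume_p t K Q = ennreal A" "0 < A" "mixed_volume_p s K Q = ennreal B" "0 < B"
    and ab: "0 < a" "0 < b" "a + b = 1"
  shows "mixed_volume_p (a * t + b * s) K Q \<le> ennreal (A powr a * B powr b)"
proof -
  let ?S = "sphere (0::'a) 1" and ?M = "surface_area_measure K" and ?n = "real DIM('a)"
  define f where "f p u = support_fun Q u powr p * support_fun K u powr (1 - p)" for p u
  have pos: "0 < support_fun Q u" "0 < support_fun K u" if "u \<in> ?S" for u
    using that K Q by (auto intro: support_fun_pos)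
  have "bounded K" "bounded Q"
    using K Q by (auto simp: convex_bodies_0_def convex_body_def compact_imp_bounded)
  then have "continuous_on ?S (support_fun K)" "continuous_on ?S (support_fun Q)"
    using K Q by (auto intro!: continuous_on_support_fun convex_bodies_0_not_empty)
  then have "continuous_on ?S (f p)" for p
    unfolding f_def using pos by (intro continuous_intros) force+
  then have [measurable]: "f p \<in> borel_measurable ?M" for p
    using borel_measurable_continuous_on_restrict[of ?S "f p"]
    by (simp add: measurable_cong_sets[OF sets_surface_area_measure refl])
  have fpos: "0 < f p u" if "u \<in> ?S" for p u
    using pos[OF that] by (simp add: f_def)
  have interp: "f (a * t + b * s) u = f t u powr a * f s u powr b" if "u \<in> ?S" for u
  proof -
    have e: "1 - (a * t + b * s) = (1 - t) * a + (1 - s) * b"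
      using ab(3) by (simp add: algebra_simps)
    show ?thesis
      unfolding f_def e using pos[OF that]
      by (simp add: powr_mult powr_powr powr_add mult.commute mult.left_commute)
  qed
  have int: "(\<integral>\<^sup>+u. ennreal (f p u) \<partial>?M) = ennreal (?n * C)"
    if "mixed_volume_p p K Q = ennreal C" "0 < C" for p C
  proof -
    have "ennreal ?n * mixed_volume_p p K Q = (\<integral>\<^sup>+u. ennreal (f p u) \<partial>?M)"
      unfolding mixed_volume_p_def f_def[symmetric]
      by (simp add: mult.assoc[symmetric] ennreal_mult[symmetric] del: ennreal_of_nat_eq_real_of_nat)
    then show ?thesis using that by (simp add: ennreal_mult')
  qed
  have "(\<integral>\<^sup>+u. ennreal (f t u powr a * f s u powr b) \<partial>?M)
      \<le> ennreal ((?n * A) powr a * (?n * B) powr b)"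
    using V ab fpos by (intro nn_integral_Holder int) auto
  \<comment> \<open>The factors \<open>?n\<close> recombine because \<open>a + b = 1\<close>; the
    normalisation \<open>1 / ?n\<close> then cancels them.\<close>
  also have "(?n * A) powr a * (?n * B) powr b = ?n * (A powr a * B powr b)"
  proof -
    have "?n powr a * ?n powr b = ?n" using ab(3) by (simp flip: powr_add)
    then show ?thesis by (simp add: powr_mult mult_ac)
  qed
  also have "(\<integral>\<^sup>+u. ennreal (f t u powr a * f s u powr b) \<partial>?M)
      = (\<integral>\<^sup>+u. ennreal (f (a * t + b * s) u) \<partial>?M)"
    by (intro nn_integral_cong) (simp add: interp)
  finally have "mixed_volume_p (a * t + b * s) K Q
      \<le> ennreal (1 / ?n) * ennreal (?n * (A powr a * B powr b))"
    unfolding mixed_volume_p_def f_def[symmetric] by (intro mult_left_mono) auto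
  also have "\<dots> = ennreal (A powr a * B powr b)"
    by (simp flip: ennreal_mult)
  finally show ?thesis .
qed

text \<open>Raising to the power \<open>n + p\<close> clears the denominators in the exponents. In
  the resulting product the exponents of \<open>n\<close> and of the polar volume are affine in
  \<open>p\<close> and split exactly with weights \<open>a\<close> and \<open>b\<close>; the
  inequality comes from the mixed volume alone. The root is left untaken, since its effect on the
  order depends on the sign of \<open>n + r\<close>.\<close>

lemma geominimal_functional_log_convex:
  fixes K Q :: "'a::euclidean_space set" and r s t :: real
  defines "n \<equiv> real DIM('a)"
  assumes K: "K \<in> convex_bodies_0" and Q: "Q \<in> convex_bodies_0"
    and m: "emeasure (surface_area_measure K) (sphere 0 1) \<noteq> 0"
      "emeasure (surface_area_measure K) (sphere 0 1) \<noteq> top"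
    and nz: "n + r \<noteq> 0" "n + s \<noteq> 0" "n + t \<noteq> 0"
    and ab: "0 < a" "0 < b" "a + b = 1" "r = a * t + b * s"
  obtains x y z where "0 < x" "0 < y" "0 < z" "geominimal_functional r K Q = ennreal x"
    "geominimal_functional t K Q = ennreal y" "geominimal_functional s K Q = ennreal z"
    "x powr (n + r) \<le> y powr (a * (n + t)) * z powr (b * (n + s))"
proof -
  have "\<exists>v>0. mixed_volume_p p K Q = ennreal v" for p
    using mixed_volume_p_pos_finite[OF K Q, of p] m
    by (cases "mixed_volume_p p K Q") (auto intro!: exI[of _ "enn2real (mixed_volume_p p K Q)"])
  then obtain v where v: "\<And>p. 0 < v p" "\<And>p. mixed_volume_p p K Q = ennreal (v p)" by metis
  obtain w where w: "emeasure lborel (polar_body Q) = ennreal w" "0 < w"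
    using emeasure_polar_body_pos_finite[OF Q] by (cases "emeasure lborel (polar_body Q)") auto
  have n: "0 < n" by (simp add: n_def)
  define \<phi> where "\<phi> p = n * v p powr (n / (n + p)) * w powr (p / (n + p))" for p
  have \<phi>_pos: "0 < \<phi> p" for p
    using v(1)[of p] w n by (simp add: \<phi>_def)
  have F: "geominimal_functional p K Q = ennreal (\<phi> p)" for p
    unfolding geominimal_functional_def \<phi>_def v w n_def[symmetric]
    using v w n by (simp add: epowr_ennreal flip: ennreal_mult)
  have pw: "\<phi> p powr (n + p) = n powr (n + p) * v p powr n * w powr p" if "n + p \<noteq> 0" for p
    using that n by (simp add: \<phi>_def powr_mult powr_powr)
  have "ennreal (v r) \<le> ennreal (v t powr a * v s powr b)"
    using mixed_volume_p_log_convex[OF K Q v(2) v(1) v(2) v(1) ab(1-3)] v(2) ab(4) by metis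
  then have "v r powr n \<le> (v t powr a * v s powr b) powr n"
    using v(1)[of r] n by (intro powr_mono2) (auto simp: ennreal_le_iff)
  then have "\<phi> r powr (n + r) \<le> n powr (n + r) * (v t powr a * v s powr b) powr n * w powr r"
    unfolding pw[OF nz(1)] by (intro mult_right_mono mult_left_mono) auto
  also have "\<dots> = (\<phi> t powr (n + t)) powr a * (\<phi> s powr (n + s)) powr b"
  proof -
    have nr: "n + r = (n + t) * a + (n + s) * b"
    proof -
      have "n + r = n * (a + b) + r" using ab(3) by simp
      then show ?thesis using ab(4) by (simp add: algebra_simps)
    qed
    have r: "r = t * a + s * b" using ab(4) by (simp add: mult.commute)
    show ?thesis
      unfolding pw[OF nz(2)] pw[OF nz(3)] nr unfolding r
      by (simp add: powr_mult powr_powr powr_add distrib_left mult_ac)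
  qed
  finally have "\<phi> r powr (n + r) \<le> \<phi> t powr (a * (n + t)) * \<phi> s powr (b * (n + s))"
    by (simp add: powr_powr mult.commute)
  then show thesis by (intro that[of "\<phi> r" "\<phi> t" "\<phi> s"] \<phi>_pos F)
qed

section \<open>The inequalities for a fixed body \<open>Q\<close>\<close>

text \<open>Here \<open>n + r > 0\<close>, so taking the \<open>(n + r)\<close>-th root of the
  log-convexity estimate preserves the order.\<close>

lemma geominimal_functional_le:
  fixes K Q :: "'a::euclidean_space set" and r s t :: real
  defines "n \<equiv> real DIM('a)"
  assumes K: "K \<in> convex_bodies_0" and Q: "Q \<in> convex_bodies_0"
    and lt: "-n < t" "t < r" "r < s"
  shows "geominimal_functional r K Q
    \<le> geominimal_functional t K Q epowr ((r - s) * (n + t) / ((t - s) * (n + r)))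
      * geominimal_functional s K Q epowr ((t - r) * (n + s) / ((t - s) * (n + r)))"
    (is "_ \<le> _ epowr ?a * _ epowr ?b")
proof -
  have ab_pos: "0 < ?a" "0 < ?b"
    using lt by (auto intro!: divide_neg_neg mult_neg_pos)
  let ?m = "emeasure (surface_area_measure K) (sphere 0 1)"
  consider "?m = 0" | "?m = top" | "?m \<noteq> 0" "?m \<noteq> top" by blast
  then show ?thesis
  proof cases
    case 1
    then show ?thesis
      using lt geominimal_functional_degenerate(1)[OF K Q 1, of r] by (simp add: n_def)
  next
    \<comment> \<open>With infinite mass both factors on the right are \<open>\<infinity>\<close>,
      and both exponents are positive.\<close>
    case 2
    then show ?thesis
      using lt ab_pos geominimal_functional_degenerate(2)[OF K Q 2, of t]
        geominimal_functional_degenerate(2)[OF K Q 2, of s]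
      by (simp add: n_def ennreal_powr_def)
  next
    case 3
    \<comment> \<open>The weights expressing \<open>r\<close> as a convex combination of
      \<open>t\<close> and \<open>s\<close>; \<open>?a\<close> is
      \<open>a * (n + t) / (n + r)\<close> and \<open>?b\<close> is
      \<open>b * (n + s) / (n + r)\<close>.\<close>
    define a b where "a = (r - s) / (t - s)" and "b = (t - r) / (t - s)"
    have ab: "0 < a" "0 < b" "a + b = 1" "r = a * t + b * s"
      using lt by (auto simp: a_def b_def divide_neg_neg divide_simps) (auto simp: algebra_simps)
    obtain x y z where F: "0 < x" "0 < y" "0 < z" "geominimal_functional r K Q = ennreal x"
      "geominimal_functional t K Q = ennreal y" "geominimal_functional s K Q = ennreal z"
      "x powr (n + r) \<le> y powr (a * (n + t)) * z powr (b * (n + s))"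
      using geominimal_functional_log_convex[OF K Q 3 _ _ _ ab] lt unfolding n_def by auto
    have "x = (x powr (n + r)) powr (1 / (n + r))" using F lt by (simp add: powr_powr)
    also have "\<dots> \<le> (y powr (a * (n + t)) * z powr (b * (n + s))) powr (1 / (n + r))"
      using F lt by (intro powr_mono2) auto
    also have "\<dots> = y powr ?a * z powr ?b"
      using F lt by (simp add: powr_mult powr_powr a_def b_def)
    finally show ?thesis
      using F by (simp add: epowr_ennreal ennreal_leI flip: ennreal_mult)
  qed
qed

text \<open>Here \<open>n + r < 0\<close>, so taking the \<open>(n + r)\<close>-th root reverses the
  order. The factor at \<open>s\<close> gets a negative exponent, because \<open>n + s\<close> and
  \<open>n + r\<close> have opposite signs.\<close>

lemma geominimal_functional_ge:
  fixes K Q :: "'a::euclidean_space set" and r s t :: real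
  defines "n \<equiv> real DIM('a)"
  assumes K: "K \<in> convex_bodies_0" and Q: "Q \<in> convex_bodies_0"
    and lt: "t < r" "r < -n" "-n < s"
  shows "geominimal_functional t K Q epowr ((r - s) * (n + t) / ((t - s) * (n + r)))
      * geominimal_functional s K Q epowr ((t - r) * (n + s) / ((t - s) * (n + r)))
    \<le> geominimal_functional r K Q"
    (is "_ epowr ?a * _ epowr ?b \<le> _")
proof -
  have ab_sign: "0 < ?a" "?b < 0"
    using lt by (auto intro!: divide_neg_pos divide_pos_pos mult_neg_pos mult_neg_neg)
  let ?m = "emeasure (surface_area_measure K) (sphere 0 1)"
  consider "?m = 0" | "?m = top" | "?m \<noteq> 0" "?m \<noteq> top" by blast
  then show ?thesis
  proof cases
    case 1
    then show ?thesis
      using lt geominimal_functional_degenerate(1)[OF K Q 1, of r] by (simp add: n_def)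
  next
    \<comment> \<open>Since \<open>n + t < 0\<close>, infinite mass makes the functional at
      \<open>t\<close> zero, and its positive power annihilates the left side.\<close>
    case 2
    then show ?thesis
      using lt ab_sign geominimal_functional_degenerate(2)[OF K Q 2, of t]
      by (simp add: n_def ennreal_powr_def)
  next
    case 3
    define a b where "a = (r - s) / (t - s)" and "b = (t - r) / (t - s)"
    have ab: "0 < a" "0 < b" "a + b = 1" "r = a * t + b * s"
      using lt by (auto simp: a_def b_def divide_neg_neg divide_simps) (auto simp: algebra_simps)
    obtain x y z where F: "0 < x" "0 < y" "0 < z" "geominimal_functional r K Q = ennreal x"
      "geominimal_functional t K Q = ennreal y" "geominimal_functional s K Q = ennreal z"
      "x powr (n + r) \<le> y powr (a * (n + t)) * z powr (b * (n + s))"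
      using geominimal_functional_log_convex[OF K Q 3 _ _ _ ab] lt unfolding n_def by auto
    have "y powr ?a * z powr ?b = (y powr (a * (n + t)) * z powr (b * (n + s))) powr (1 / (n + r))"
      using F lt by (simp add: powr_mult powr_powr a_def b_def)
    also have "\<dots> \<le> (x powr (n + r)) powr (1 / (n + r))"
      using F lt by (intro powr_mono2') auto
    also have "\<dots> = x" using F lt by (simp add: powr_powr)
    finally show ?thesis
      using F by (simp add: epowr_ennreal ennreal_leI flip: ennreal_mult)
  qed
qed

section \<open>Passing to the infimum or supremum over \<open>Q\<close>\<close>

text \<open>Both factors that involve \<open>Q\<close> have exponent zero. As
  \<open>0 powr 0\<close> is \<open>0\<close>, positivity of the support function is what makes its
  power equal to \<open>1\<close>.\<close>

lemma geominimal_functional_0: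
  assumes "K \<in> convex_bodies_0" "Q \<in> convex_bodies_0" "Q' \<in> convex_bodies_0"
  shows "geominimal_functional 0 K Q = geominimal_functional 0 K Q'"
proof -
  have "mixed_volume_p 0 K Q = mixed_volume_p 0 K Q'"
    unfolding mixed_volume_p_def
    using assms support_fun_pos[of Q] support_fun_pos[of Q']
    by (intro arg_cong2[where f = "(*)"] nn_integral_cong) force+
  then show ?thesis by (simp add: geominimal_functional_def ennreal_powr_def)
qed

text \<open>Replacing the factor at \<open>t\<close> by its supremum leaves a bound in which only
  the factor at \<open>s\<close> depends on \<open>Q\<close>; the infimum over \<open>Q\<close> can
  then be taken there, provided the constant in front is finite.\<close>

lemma geominimal_surface_area_cyclic_pos:
  fixes K :: "'a::euclidean_space set" and r s t :: real
  defines "n \<equiv> real DIM('a)"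
  assumes K: "K \<in> convex_bodies_0" and lt: "-n < t" "t < 0" "0 < r" "r < s"
  shows "geominimal_surface_area r K
    \<le> geominimal_surface_area t K epowr ((r - s) * (n + t) / ((t - s) * (n + r)))
      * geominimal_surface_area s K epowr ((t - r) * (n + s) / ((t - s) * (n + r)))"
    (is "_ \<le> _ epowr ?a * _ epowr ?b")
proof -
  let ?F = "\<lambda>p. geominimal_functional p K" and ?G = "\<lambda>p. geominimal_surface_area p K"
  have ne: "convex_bodies_0 \<noteq> ({} :: 'a set set)" using K by auto
  have G: "?G r = (INF Q\<in>convex_bodies_0. ?F r Q)" "?G s = (INF Q\<in>convex_bodies_0. ?F s Q)"
    "?G t = (SUP Q\<in>convex_bodies_0. ?F t Q)"
    using lt by (auto simp: geominimal_surface_area_def)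
  have ab_pos: "0 < ?a" "0 < ?b"
    using lt by (auto intro!: divide_neg_neg mult_neg_pos)
  have le: "?G r \<le> ?G t epowr ?a * ?F s Q epowr ?b" if Q: "Q \<in> convex_bodies_0" for Q
  proof -
    have "?G r \<le> ?F r Q" unfolding G by (rule INF_lower[OF Q])
    also have "\<dots> \<le> ?F t Q epowr ?a * ?F s Q epowr ?b"
      using geominimal_functional_le[OF K Q] lt unfolding n_def by auto
    also have "\<dots> \<le> ?G t epowr ?a * ?F s Q epowr ?b"
      unfolding G by (intro mult_right_mono epowr_mono ab_pos SUP_upper Q) auto
    finally show ?thesis .
  qed
  show ?thesis
  proof (cases "?G t = top \<and> ?G s = 0")
    case False
    then consider "?G t \<noteq> top" | "?G t = top" "?G s \<noteq> 0" by blast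
    then show ?thesis
    proof cases
      case 1
      then show ?thesis
        using le_times_INF_epowr[OF ab_pos(2) _ ne, of "?G t epowr ?a" "?G r" "?F s"] le ab_pos
        unfolding G(2) by (simp add: epowr_eq_top_iff)
    next
      case 2
      then have "?G t epowr ?a = top" "?G s epowr ?b \<noteq> 0"
        by (simp_all add: epowr_eq_top_iff[OF ab_pos(1)] epowr_eq_0_iff[OF ab_pos(2)])
      then show ?thesis by (simp add: ennreal_top_mult)
    qed
  next
    case True
    \<comment> \<open>The product $\infty \cdot 0$ carries no information. Interpolate between $0$ and $s$
      instead: at exponent $0$ the functional does not depend on \<open>Q\<close>.\<close>
    define c where "c = ?F 0 K epowr ((r - s) * n / (- s * (n + r)))"
    let ?d = "(- r) * (n + s) / (- s * (n + r))"
    have le0: "?G r \<le> c * ?F s Q epowr ?d" if Q: "Q \<in> convex_bodies_0" for Q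
    proof -
      have "?G r \<le> ?F r Q" unfolding G by (rule INF_lower[OF Q])
      also have "\<dots> \<le> c * ?F s Q epowr ?d"
        using geominimal_functional_le[OF K Q, of 0 r s] lt geominimal_functional_0[OF K K Q]
        unfolding n_def c_def by simp
      finally show ?thesis .
    qed
    have d: "0 < ?d" "0 < (r - s) * n / (- s * (n + r))"
      using lt unfolding n_def by (intro divide_neg_neg mult_neg_pos; simp)+
    \<comment> \<open>Infinite mass would make every functional at \<open>s\<close> infinite,
      contradicting \<open>?G s = 0\<close>. Finite mass in turn makes \<open>c\<close> finite, so
      the infimum can be taken.\<close>
    have "emeasure (surface_area_measure K) (sphere 0 1) \<noteq> top"
    proof
      assume "emeasure (surface_area_measure K) (sphere 0 1) = top"
      then have "?F s Q = top" if "Q \<in> convex_bodies_0" for Q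
        using geominimal_functional_degenerate(2)[OF K that, of _ s] lt unfolding n_def by auto
      then show False using True ne unfolding G(2) by simp
    qed
    then have "?F 0 K \<noteq> top"
      using mixed_volume_p_pos_finite(2)[OF K K, of 0]
      by (simp add: geominimal_functional_def ennreal_powr_def ennreal_mult_eq_top_iff)
    then have "c \<noteq> top" unfolding c_def using d by (simp add: epowr_eq_top_iff)
    then have "?G r \<le> c * ?G s epowr ?d"
      unfolding G(2) using d ne le0 by (intro le_times_INF_epowr) auto
    moreover have "?G s epowr ?d = 0" using True by (simp only: epowr_eq_0_iff[OF d(1)])
    ultimately have "?G r = 0" by simp
    then show ?thesis by simp
  qed
qed

text \<open>All three quantities are suprema and both exponents are positive, so each factor on the
  right may be bounded by its supremum separately.\<close>

lemma geominimal_surface_area_cyclic_neg: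
  fixes K :: "'a::euclidean_space set" and r s t :: real
  defines "n \<equiv> real DIM('a)"
  assumes K: "K \<in> convex_bodies_0" and lt: "-n < t" "t < r" "r < s" "s < 0"
  shows "geominimal_surface_area r K
    \<le> geominimal_surface_area t K epowr ((r - s) * (n + t) / ((t - s) * (n + r)))
      * geominimal_surface_area s K epowr ((t - r) * (n + s) / ((t - s) * (n + r)))"
    (is "_ \<le> _ epowr ?a * _ epowr ?b")
proof -
  let ?F = "\<lambda>p. geominimal_functional p K"
  have G: "geominimal_surface_area p K = (SUP Q\<in>convex_bodies_0. ?F p Q)" if "p < 0" for p
    using that by (auto simp: geominimal_surface_area_def)
  have ab_pos: "0 < ?a" "0 < ?b"
    using lt by (auto intro!: divide_neg_neg mult_neg_pos)
  have "?F r Q \<le> (SUP Q\<in>convex_bodies_0. ?F t Q) epowr ?a * (SUP Q\<in>convex_bodies_0. ?F s Q) epowr ?b"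
    if Q: "Q \<in> convex_bodies_0" for Q
  proof -
    have "?F r Q \<le> ?F t Q epowr ?a * ?F s Q epowr ?b"
      using geominimal_functional_le[OF K Q] lt unfolding n_def by auto
    also have "\<dots> \<le> (SUP Q\<in>convex_bodies_0. ?F t Q) epowr ?a * (SUP Q\<in>convex_bodies_0. ?F s Q) epowr ?b"
      by (intro mult_mono epowr_mono ab_pos SUP_upper Q) auto
    finally show ?thesis .
  qed
  then show ?thesis using lt by (auto simp: G intro!: SUP_least)
qed

text \<open>The negative exponent at \<open>s\<close> means that passing to the supremum there
  decreases the product. After that only the factor at \<open>t\<close> depends on \<open>Q\<close>,
  and its supremum can be taken.\<close>

lemma geominimal_surface_area_cyclic_below:
  fixes K :: "'a::euclidean_space set" and r s t :: real
  defines "n \<equiv> real DIM('a)"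
  assumes K: "K \<in> convex_bodies_0" and lt: "t < r" "r < -n" "-n < s" "s < 0"
  shows "geominimal_surface_area t K epowr ((r - s) * (n + t) / ((t - s) * (n + r)))
      * geominimal_surface_area s K epowr ((t - r) * (n + s) / ((t - s) * (n + r)))
    \<le> geominimal_surface_area r K"
    (is "_ epowr ?a * _ epowr ?b \<le> _")
proof -
  let ?F = "\<lambda>p. geominimal_functional p K" and ?G = "\<lambda>p. geominimal_surface_area p K"
  have G: "?G p = (SUP Q\<in>convex_bodies_0. ?F p Q)" if "p < 0" for p
    using that by (auto simp: geominimal_surface_area_def)
  have neg: "t < 0" "r < 0" "s < 0" using lt by (auto simp: n_def)
  have ab_sign: "0 < ?a" "?b < 0"
    using lt by (auto intro!: divide_neg_pos divide_pos_pos mult_neg_pos mult_neg_neg)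
  have le: "?F t Q epowr ?a * ?G s epowr ?b \<le> ?G r" if Q: "Q \<in> convex_bodies_0" for Q
  proof -
    have "?F t Q epowr ?a * ?G s epowr ?b \<le> ?F t Q epowr ?a * ?F s Q epowr ?b"
      unfolding G[OF neg(3)] by (intro mult_left_mono epowr_antimono ab_sign SUP_upper Q) auto
    also have "\<dots> \<le> ?F r Q"
      using geominimal_functional_ge[OF K Q] lt unfolding n_def by auto
    also have "\<dots> \<le> ?G r" unfolding G[OF neg(2)] by (rule SUP_upper[OF Q])
    finally show ?thesis .
  qed
  show ?thesis
  proof (cases "?G s = 0")
    case False
    then have "?G s epowr ?b \<noteq> top"
      using ab_sign by (simp add: ennreal_powr_def)
    then show ?thesis
      unfolding G[OF neg(1)] using le ab_sign by (intro SUP_epowr_times_le) auto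
  next
    \<comment> \<open>Now the factor at \<open>s\<close> is \<open>0\<close> to a negative power,
      hence \<open>\<infinity>\<close>. This happens only for zero mass, and then
      \<open>n + r < 0\<close> makes the right side \<open>\<infinity>\<close> too.\<close>
    case True
    then have "?F s K \<le> 0" using SUP_upper[OF K, of "?F s"] by (simp add: G[OF neg(3)])
    have "emeasure (surface_area_measure K) (sphere 0 1) = 0"
    proof (rule ccontr)
      assume m: "emeasure (surface_area_measure K) (sphere 0 1) \<noteq> 0"
      \<comment> \<open>The positive exponent keeps a nonzero mixed volume nonzero, even an infinite
        one; the polar volume is positive and finite, so its negative power does not vanish.\<close>
      have "0 < n / (n + s)" using lt by (simp add: n_def)
      then have "?F s K \<noteq> 0"
        using mixed_volume_p_pos_finite(1)[OF K K m, of s] emeasure_polar_body_pos_finite[OF K] lt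
        by (auto simp: geominimal_functional_def n_def ennreal_powr_def ennreal_eq_0_iff enn2real_eq_0_iff
            divide_less_0_iff)
      with \<open>?F s K \<le> 0\<close> show False by simp
    qed
    then have "?F r K = top"
      using geominimal_functional_degenerate(1)[OF K K, of 0 r] lt by (simp add: n_def)
    then have "?G r = top" using SUP_upper[OF K, of "?F r"] by (simp add: G[OF neg(2)] top_unique)
    then show ?thesis by simp
  qed
qed

theorem theorem5p1:
  fixes K :: "'a::euclidean_space set" and n r s t :: real
  assumes "n = real DIM('a)"
    and "convex_body K" and "0 \<in> interior K"
  shows "((-n < t \<and> t < 0 \<and> 0 < r \<and> r < s) \<or> (-n < s \<and> s < 0 \<and> 0 < r \<and> r < t) \<longrightarrow>
           geominimal_surface_area r K
             \<le> geominimal_surface_area t K epowr (((r - s) * (n + t)) / ((t - s) * (n + r)))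
               * geominimal_surface_area s K epowr (((t - r) * (n + s)) / ((t - s) * (n + r))))
       \<and> ((-n < t \<and> t < r \<and> r < s \<and> s < 0) \<or> (-n < s \<and> s < r \<and> r < t \<and> t < 0) \<longrightarrow>
           geominimal_surface_area r K
             \<le> geominimal_surface_area t K epowr (((r - s) * (n + t)) / ((t - s) * (n + r)))
               * geominimal_surface_area s K epowr (((t - r) * (n + s)) / ((t - s) * (n + r))))
       \<and> ((t < r \<and> r < -n \<and> -n < s \<and> s < 0) \<or> (s < r \<and> r < -n \<and> -n < t \<and> t < 0) \<longrightarrow>
           geominimal_surface_area r K
             \<ge> geominimal_surface_area t K epowr (((r - s) * (n + t)) / ((t - s) * (n + r)))
               * geominimal_surface_area s K epowr (((t - r) * (n + s)) / ((t - s) * (n + r))))"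
proof -
  have K: "K \<in> convex_bodies_0"
    using assms by (simp add: convex_bodies_0_def)
  \<comment> \<open>Exchanging \<open>s\<close> and \<open>t\<close> negates numerator and
    denominator of each exponent, so the two exponents trade places. The second ordering in each
    claim is thus the first with \<open>s\<close> and \<open>t\<close> exchanged.\<close>
  have swap: "(r - t) * (n + s) / ((s - t) * (n + r)) = (t - r) * (n + s) / ((t - s) * (n + r))"
    "(s - r) * (n + t) / ((s - t) * (n + r)) = (r - s) * (n + t) / ((t - s) * (n + r))"
    by (metis minus_diff_eq minus_divide_divide mult_minus_left)+
  note cyclic = geominimal_surface_area_cyclic_pos[OF K] geominimal_surface_area_cyclic_neg[OF K]
    geominimal_surface_area_cyclic_below[OF K]
  show ?thesis
    using cyclic[of t r s] cyclic[of s r t] unfolding assms(1)[symmetric] swap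
    by (auto simp: mult.commute)
qed

end
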